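(* For every exact zero-quality desk selector $r$, $$U^0(\mu,p;c)=\widetilde U^0(\mu,p)-\frac{\nu c}{\rho}\mu\qquad\text{for all }(\mu,p)\in[0,1]\times\mathcal P.$$ Consequently, the zero-quality reset correspondence $\mu\mapsto\arg\max_{p'\in\mathcal P}U^0(\mu,p';c)$ and, conditional on its selector $r$, the strategic value $V^{0,r}$ are independent of $c$.
   Context: Constants: $\rho,\nu,\kappa,v,\zeta>0$ (discount rate, customer arrival rate, price-reset rate, value of high quality, logit scale), quality cost $c>0$, signal precision $q\in(1/2,1)$, $d=2q-1$. Finite price menu $\mathcal P\subset(0,\infty)$. $\mu\in[0,1]$ is the public probability that the firm is the commitment type, which always supplies high quality at cost $c$ per customer opportunity; the strategic type here always supplies low quality at no cost. $\pi_H(\lambda)=\frac{q\lambda}{(1-q)+d\lambda}$, $\pi_L(\lambda)=\frac{(1-q)\lambda}{q-d\lambda}$, $\Lambda(z)=e^z/(1+e^z)$, $b_s(\lambda,p)=\Lambda((v\pi_s(\lambda)-p)/\zeta)$, $s\in\{H,L\}$. $A_H^0(\mu,p)=qb_H(\mu,p)+(1-q)b_L(\mu,p)$, $A_L^0=(1-q)b_H+qb_L$, $D^0=A_H^0-A_L^0$, $\bar A^0=A_L^0+\mu D^0$, $\beta^0=-\nu\mu(1-\mu)D^0$, $J^0=\mu A_H^0/\bar A^0$. $\phi_t=\phi^p_t(\mu)$ is the flow of $\dot\mu=\beta^0(\mu,p)$ with $p$ fixed, and $S_p(t)=\exp\{-\int_0^t[\kappa+\nu\bar A^0(\phi_s,p)]ds\}$.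 Gross aggregate value $\widetilde U^0$ is the unique bounded solution of $$f(\mu,p)=\int_0^\infty e^{-\rho t}S_p(t)\big[\nu p\bar A^0(\phi_t,p)+\kappa\max_{p'\in\mathcal P}f(\phi_t,p')+\nu\bar A^0(\phi_t,p)f(J^0(\phi_t,p),p)\big]dt.$$ Aggregate (posterior expected) value at cost $c$, $U^0(\cdot;c)$, is the bounded solution of the same identity with running payoff $\nu p\bar A^0(\phi_t,p)$ replaced by $\nu\{p\bar A^0(\phi_t,p)-c\phi_t\}$; the desk resets by an exact selector, i.e. a Borel probability kernel $r(\cdot\mid\mu,p)$ on $\mathcal P$ supported on $\arg\max_{p'\in\mathcal P}U^0(\mu,p';c)$, so the reset continuation is the maximum. The strategic value $V^{0,r}$ is the bounded solution of $$V(\mu,p)=\int_0^\infty e^{-\rho t-\int_0^t[\kappa+\nu A_L^0(\phi_s,p)]ds}\Big[\nu pA_L^0(\phi_t,p)+\kappa\sum_{p'}r(p'\mid\phi_t,p)V(\phi_t,p')+\nu A_L^0(\phi_t,p)V(J^0(\phi_t,p),p)\Big]dt.$$ *)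

theory Defs
  imports "HOL-Probability.Probability"
begin

text \<open>
  Parameters throughout: \<open>\<rho>\<close> discount rate, \<open>\<nu>\<close> customer arrival rate, \<open>\<kappa>\<close> price-reset rate,
  \<open>v\<close> value of high quality, \<open>\<zeta>\<close> logit scale, \<open>q\<close> signal precision, \<open>P\<close> price menu,
  \<open>c\<close> cost of high quality.
\<close>

definition pi_H :: "real \<Rightarrow> real \<Rightarrow> real" where
  "pi_H q l = q * l / ((1 - q) + (2 * q - 1) * l)"

definition pi_L :: "real \<Rightarrow> real \<Rightarrow> real" where
  "pi_L q l = (1 - q) * l / (q - (2 * q - 1) * l)"

definition logistic :: "real \<Rightarrow> real" where
  "logistic z = exp z / (1 + exp z)"

definition b_H :: "real \<Rightarrow> real \<Rightarrow> real \<Rightarrow> real \<Rightarrow> real \<Rightarrow> real" where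
  "b_H v \<zeta> q l p = logistic ((v * pi_H q l - p) / \<zeta>)"

definition b_L :: "real \<Rightarrow> real \<Rightarrow> real \<Rightarrow> real \<Rightarrow> real \<Rightarrow> real" where
  "b_L v \<zeta> q l p = logistic ((v * pi_L q l - p) / \<zeta>)"

definition A_H :: "real \<Rightarrow> real \<Rightarrow> real \<Rightarrow> real \<Rightarrow> real \<Rightarrow> real" where
  "A_H v \<zeta> q \<mu> p = q * b_H v \<zeta> q \<mu> p + (1 - q) * b_L v \<zeta> q \<mu> p"

definition A_L :: "real \<Rightarrow> real \<Rightarrow> real \<Rightarrow> real \<Rightarrow> real \<Rightarrow> real" where
  "A_L v \<zeta> q \<mu> p = (1 - q) * b_H v \<zeta> q \<mu> p + q * b_L v \<zeta> q \<mu> p"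

definition D_0 :: "real \<Rightarrow> real \<Rightarrow> real \<Rightarrow> real \<Rightarrow> real \<Rightarrow> real" where
  "D_0 v \<zeta> q \<mu> p = A_H v \<zeta> q \<mu> p - A_L v \<zeta> q \<mu> p"

definition A_bar :: "real \<Rightarrow> real \<Rightarrow> real \<Rightarrow> real \<Rightarrow> real \<Rightarrow> real" where
  "A_bar v \<zeta> q \<mu> p = A_L v \<zeta> q \<mu> p + \<mu> * D_0 v \<zeta> q \<mu> p"

definition drift :: "real \<Rightarrow> real \<Rightarrow> real \<Rightarrow> real \<Rightarrow> real \<Rightarrow> real \<Rightarrow> real" where
  "drift \<nu> v \<zeta> q \<mu> p = - \<nu> * \<mu> * (1 - \<mu>) * D_0 v \<zeta> q \<mu> p"

definition jump :: "real \<Rightarrow> real \<Rightarrow> real \<Rightarrow> real \<Rightarrow> real \<Rightarrow> real" where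
  "jump v \<zeta> q \<mu> p = \<mu> * A_H v \<zeta> q \<mu> p / A_bar v \<zeta> q \<mu> p"

text \<open>\<open>\<phi> p \<mu> t\<close> is the state at time \<open>t\<close>, started at \<open>\<mu>\<close>, while the price \<open>p\<close> is fixed; the state
  space of the flow is the unit interval.\<close>

definition is_flow ::
  "real \<Rightarrow> real \<Rightarrow> real \<Rightarrow> real \<Rightarrow> real set \<Rightarrow> (real \<Rightarrow> real \<Rightarrow> real \<Rightarrow> real) \<Rightarrow> bool" where
  "is_flow \<nu> v \<zeta> q P \<phi> \<longleftrightarrow>
     (\<forall>p\<in>P. \<forall>\<mu>\<in>{0..1}.
        \<phi> p \<mu> 0 = \<mu> \<and>
        (\<forall>t\<ge>0. \<phi> p \<mu> t \<in> {0..1} \<and>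
           (\<phi> p \<mu> has_real_derivative drift \<nu> v \<zeta> q (\<phi> p \<mu> t) p) (at t within {0..})))"

text \<open>Probability of neither a price reset nor a sale before \<open>t\<close>, where \<open>a s\<close> is the purchase
  probability at time \<open>s\<close>.\<close>

definition survival :: "real \<Rightarrow> real \<Rightarrow> (real \<Rightarrow> real) \<Rightarrow> real \<Rightarrow> real" where
  "survival \<nu> \<kappa> a t = exp (- (LBINT s:{0..t}. \<kappa> + \<nu> * a s))"

text \<open>Bounded function on \<open>[0,1] \<times> P\<close> that equals the discounted integral of \<open>G f\<close>, including that
  this Lebesgue integral exists (a divergent Bochner integral would silently be \<open>0\<close>).
  Here \<open>G f \<mu> p t\<close> is the integrand at time \<open>t\<close> for the initial condition \<open>(\<mu>, p)\<close>.
  Values of \<open>f\<close> off \<open>[0,1] \<times> P\<close> are irrelevant.\<close>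

definition bounded_solution ::
  "real \<Rightarrow> real set \<Rightarrow> ((real \<Rightarrow> real \<Rightarrow> real) \<Rightarrow> real \<Rightarrow> real \<Rightarrow> real \<Rightarrow> real) \<Rightarrow>
   (real \<Rightarrow> real \<Rightarrow> real) \<Rightarrow> bool" where
  "bounded_solution \<rho> P G f \<longleftrightarrow>
     bounded ((\<lambda>(\<mu>, p). f \<mu> p) ` ({0..1} \<times> P)) \<and>
     (\<forall>\<mu>\<in>{0..1}. \<forall>p\<in>P.
        set_integrable lborel {0..} (\<lambda>t. exp (- \<rho> * t) * G f \<mu> p t) \<and>
        f \<mu> p = (LBINT t:{0..}. exp (- \<rho> * t) * G f \<mu> p t))"

text \<open>Aggregate value with running payoff \<open>w\<close>, resetting to a maximal price.\<close>

definition aggregate_solution ::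
  "real \<Rightarrow> real \<Rightarrow> real \<Rightarrow> real \<Rightarrow> real \<Rightarrow> real \<Rightarrow> real set \<Rightarrow> (real \<Rightarrow> real \<Rightarrow> real \<Rightarrow> real) \<Rightarrow>
   (real \<Rightarrow> real \<Rightarrow> real) \<Rightarrow> (real \<Rightarrow> real \<Rightarrow> real) \<Rightarrow> bool" where
  "aggregate_solution \<rho> \<nu> \<kappa> v \<zeta> q P \<phi> w =
     bounded_solution \<rho> P (\<lambda>f \<mu> p t.
       survival \<nu> \<kappa> (\<lambda>s. A_bar v \<zeta> q (\<phi> p \<mu> s) p) t *
       (w (\<phi> p \<mu> t) p
        + \<kappa> * (MAX p'\<in>P. f (\<phi> p \<mu> t) p')
        + \<nu> * A_bar v \<zeta> q (\<phi> p \<mu> t) p * f (jump v \<zeta> q (\<phi> p \<mu> t) p) p))"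

definition is_gross_value ::
  "real \<Rightarrow> real \<Rightarrow> real \<Rightarrow> real \<Rightarrow> real \<Rightarrow> real \<Rightarrow> real set \<Rightarrow> (real \<Rightarrow> real \<Rightarrow> real \<Rightarrow> real) \<Rightarrow>
   (real \<Rightarrow> real \<Rightarrow> real) \<Rightarrow> bool" where
  "is_gross_value \<rho> \<nu> \<kappa> v \<zeta> q P \<phi> =
     aggregate_solution \<rho> \<nu> \<kappa> v \<zeta> q P \<phi> (\<lambda>\<mu> p. \<nu> * p * A_bar v \<zeta> q \<mu> p)"

definition is_aggregate_value ::
  "real \<Rightarrow> real \<Rightarrow> real \<Rightarrow> real \<Rightarrow> real \<Rightarrow> real \<Rightarrow> real set \<Rightarrow> (real \<Rightarrow> real \<Rightarrow> real \<Rightarrow> real) \<Rightarrow>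
   real \<Rightarrow> (real \<Rightarrow> real \<Rightarrow> real) \<Rightarrow> bool" where
  "is_aggregate_value \<rho> \<nu> \<kappa> v \<zeta> q P \<phi> c =
     aggregate_solution \<rho> \<nu> \<kappa> v \<zeta> q P \<phi> (\<lambda>\<mu> p. \<nu> * (p * A_bar v \<zeta> q \<mu> p - c * \<mu>))"

definition reset_set :: "real set \<Rightarrow> (real \<Rightarrow> real \<Rightarrow> real) \<Rightarrow> real \<Rightarrow> real set" where
  "reset_set P U \<mu> = {p. is_arg_max (U \<mu>) (\<lambda>p'. p' \<in> P) p}"

text \<open>Borel probability kernels on the finite menu, represented by probability mass functions.\<close>

definition exact_selector ::
  "real set \<Rightarrow> (real \<Rightarrow> real \<Rightarrow> real) \<Rightarrow> (real \<Rightarrow> real \<Rightarrow> real pmf) \<Rightarrow> bool" where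
  "exact_selector P U r \<longleftrightarrow>
     (\<forall>p\<in>P. (\<forall>p'\<in>P. (\<lambda>\<mu>. pmf (r \<mu> p) p') \<in> borel_measurable (restrict_space borel {0..1})) \<and>
            (\<forall>\<mu>\<in>{0..1}. set_pmf (r \<mu> p) \<subseteq> reset_set P U \<mu>))"

definition is_strategic_value ::
  "real \<Rightarrow> real \<Rightarrow> real \<Rightarrow> real \<Rightarrow> real \<Rightarrow> real \<Rightarrow> real set \<Rightarrow> (real \<Rightarrow> real \<Rightarrow> real \<Rightarrow> real) \<Rightarrow>
   (real \<Rightarrow> real \<Rightarrow> real pmf) \<Rightarrow> (real \<Rightarrow> real \<Rightarrow> real) \<Rightarrow> bool" where
  "is_strategic_value \<rho> \<nu> \<kappa> v \<zeta> q P \<phi> r =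
     bounded_solution \<rho> P (\<lambda>V \<mu> p t.
       survival \<nu> \<kappa> (\<lambda>s. A_L v \<zeta> q (\<phi> p \<mu> s) p) t *
       (\<nu> * p * A_L v \<zeta> q (\<phi> p \<mu> t) p
        + \<kappa> * (\<Sum>p'\<in>P. pmf (r (\<phi> p \<mu> t) p) p' * V (\<phi> p \<mu> t) p')
        + \<nu> * A_L v \<zeta> q (\<phi> p \<mu> t) p * V (jump v \<zeta> q (\<phi> p \<mu> t) p) p))"

end

theory Submission
  imports Defs
begin

text \<open>
  Along the flow with \<open>p\<close> fixed, the belief obeys \<open>x' = - \<nu> x (1 - x) D_0\<close>, and since
  \<open>A_bar + (1 - x) D_0 = A_H\<close> and \<open>A_bar * jump = x A_H\<close>,
  the derivative of \<open>- exp (- \<rho> t) * survival * x\<close> is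
  \<open>exp (- \<rho> t) * survival * (\<rho> x + \<kappa> x + \<nu> A_bar * jump)\<close>. Integrating over time shows that
  \<open>\<nu> c / \<rho> * \<mu>\<close> is exactly the discounted expected quality cost. It does not depend on the
  price, so it passes through the maximum over the menu, and \<open>U + \<nu> c / \<rho> * \<mu>\<close> solves the gross
  equation. Bounded solutions of all these equations are unique by contraction.
\<close>

section \<open>Integrals of nonnegative derivatives over the half-line\<close>

text \<open>Because \<open>f\<close> is nonnegative, integrability follows from the finite limit of
  \<open>F\<close>. The fundamental theorem is applied on the open ray
  \<open>einterval 0 \<infinity>\<close>; the endpoint 0 is a null set and is added back
  afterwards.\<close>

lemma set_integral_FTC_atLeast_nonneg:
  fixes f F :: "real \<Rightarrow> real"
  assumes deriv: "\<And>t. 0 \<le> t \<Longrightarrow> (F has_real_derivative f t) (at t within {0..})"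
    and cont: "continuous_on {0..} f"
    and nonneg: "\<And>t. 0 \<le> t \<Longrightarrow> 0 \<le> f t"
    and lim: "(F \<longlongrightarrow> L) at_top"
  shows "set_integrable lborel {0..} f" and "(LBINT t:{0..}. f t) = L - F 0"
proof -
  have interior: "at t within {0..} = at t" if "0 < t" for t :: real
    using that by (intro at_within_interior) auto
  have "(F \<longlongrightarrow> F 0) (at 0 within {0..})"
    using DERIV_continuous[OF deriv[of 0]] by (simp add: continuous_within)
  then have "(F \<longlongrightarrow> F 0) (at_right 0)"
    by (rule tendsto_within_subset) auto
  then have A: "((F \<circ> real_of_ereal) \<longlongrightarrow> F 0) (at_right 0)"
    using ereal_tendsto_simps1(2)[of F "F 0" 0] by (simp add: zero_ereal_def)
  have B: "((F \<circ> real_of_ereal) \<longlongrightarrow> L) (at_left \<infinity>)"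
    using lim by (simp add: ereal_tendsto_simps1)
  have D: "DERIV F t :> f t" if "0 < ereal t" "ereal t < \<infinity>" for t
    using deriv[of t] that by (simp add: interior)
  have C: "isCont f t" if "0 < ereal t" "ereal t < \<infinity>" for t
    using cont that interior[of t] by (auto simp: continuous_on_eq_continuous_within dest!: bspec[of _ _ t])
  have N: "AE t in lborel. 0 < ereal t \<longrightarrow> ereal t < \<infinity> \<longrightarrow> 0 \<le> f t"
    using nonneg by auto
  note FTC = interval_integral_FTC_nonneg[OF _ D C N A B]
  have open_ray: "einterval 0 \<infinity> = {0<..}"
    by (auto simp: einterval_def)
  have int_open: "set_integrable lborel {0<..} f" and val_open: "(LBINT t:{0<..}. f t) = L - F 0"
    using FTC by (simp_all add: open_ray interval_lebesgue_integral_def)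
  have int_pt: "set_integrable lborel {0} f"
    using borel_integrable_atLeastAtMost'[of 0 0 f] by simp
  have ray: "{0..} = {0<..} \<union> {0::real}"
    by auto
  show "set_integrable lborel {0..} f"
    unfolding ray by (intro set_integrable_Un int_open int_pt) auto
  have "(LBINT t:{0}. f t) = 0"
    using set_borel_integral_eq_integral(2)[OF int_pt] by simp
  then show "(LBINT t:{0..}. f t) = L - F 0"
    unfolding ray by (subst set_integral_Un[OF _ int_open int_pt]) (auto simp: val_open)
qed

section \<open>Survival probabilities and discounted integrals along a path of purchase
  probabilities\<close>

context
  fixes \<nu> \<kappa> :: real and a :: "real \<Rightarrow> real"
  assumes \<nu>: "0 < \<nu>" and \<kappa>: "0 < \<kappa>"
    and a_cont: "continuous_on {0..} a"
    and a_nonneg: "\<And>t. 0 \<le> t \<Longrightarrow> 0 \<le> a t"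
begin

lemma set_integrable_hazard: "set_integrable lborel {0..t} (\<lambda>s. \<kappa> + \<nu> * a s)"
  by (intro borel_integrable_atLeastAtMost' continuous_intros continuous_on_subset[OF a_cont]) auto

lemma survival_has_real_derivative:
  assumes "0 \<le> t"
  shows "(survival \<nu> \<kappa> a has_real_derivative - (\<kappa> + \<nu> * a t) * survival \<nu> \<kappa> a t) (at t within {0..})"
proof -
  define H where "H = (\<lambda>t. integral {0..t} (\<lambda>s. \<kappa> + \<nu> * a s))"
  have S: "survival \<nu> \<kappa> a = (\<lambda>t. exp (- H t))"
    by (rule ext) (simp add: survival_def H_def set_borel_integral_eq_integral(2)[OF set_integrable_hazard])
  \<comment> \<open>The right end \<open>t+1\<close> keeps \<open>t\<close> away from the upper
    boundary, so near \<open>t\<close> the compact interval agrees with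
    \<open>{0..}\<close>.\<close>
  have "(H has_real_derivative \<kappa> + \<nu> * a t) (at t within {0..t+1})"
    unfolding H_def
    by (rule integral_has_real_derivative)
      (use assms in \<open>auto intro!: continuous_intros continuous_on_subset[OF a_cont]\<close>)
  moreover have "at t within {0..t+1} = at t within {0..}"
    by (rule at_within_nhd[of _ "{..<t+1}"]) auto
  ultimately have "(H has_real_derivative \<kappa> + \<nu> * a t) (at t within {0..})"
    by simp
  then show ?thesis
    unfolding S by (auto intro!: derivative_eq_intros)
qed

lemma continuous_on_survival: "continuous_on {0..} (survival \<nu> \<kappa> a)"
  by (rule DERIV_continuous_on[OF survival_has_real_derivative]) auto

lemma survival_pos: "0 < survival \<nu> \<kappa> a t"
  by (simp add: survival_def)

lemma survival_le_1: "survival \<nu> \<kappa> a t \<le> 1"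
proof -
  have "0 \<le> (LBINT s:{0..t}. \<kappa> + \<nu> * a s)"
    unfolding set_lebesgue_integral_def
    by (rule integral_nonneg_AE) (use \<nu> \<kappa> a_nonneg in \<open>auto simp: add_nonneg_nonneg indicator_def\<close>)
  then show ?thesis
    by (simp add: survival_def)
qed

lemma survival_0: "survival \<nu> \<kappa> a 0 = 1"
  using set_borel_integral_eq_integral(2)[OF set_integrable_hazard[of 0]] by (simp add: survival_def)

text \<open>\<open>g\<close> is the derivative of
  \<open>- (exp (- \<rho> * t) * survival * x)\<close>, which vanishes at infinity since
  \<open>survival\<close> and \<open>x\<close> are bounded by 1; only the value at 0 remains. The
  path \<open>x\<close> is kept general for two uses: the constant 1 gives a total mass, the belief
  flow gives the discounted quality cost.\<close>

lemma discounted_integral_of_derivative: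
  fixes x y :: "real \<Rightarrow> real"
  assumes \<rho>: "0 < \<rho>"
    and x: "\<And>t. 0 \<le> t \<Longrightarrow> (x has_real_derivative y t) (at t within {0..})"
    and x_unit: "\<And>t. 0 \<le> t \<Longrightarrow> x t \<in> {0..1}"
    and y_cont: "continuous_on {0..} y"
    and nonneg: "\<And>t. 0 \<le> t \<Longrightarrow> 0 \<le> (\<rho> + \<kappa> + \<nu> * a t) * x t - y t"
  defines "g \<equiv> \<lambda>t. exp (- \<rho> * t) * (survival \<nu> \<kappa> a t * ((\<rho> + \<kappa> + \<nu> * a t) * x t - y t))"
  shows "set_integrable lborel {0..} g" and "(LBINT t:{0..}. g t) = x 0"
proof -
  define F where "F = (\<lambda>t. - (exp (- \<rho> * t) * (survival \<nu> \<kappa> a t * x t)))"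
  have x_cont: "continuous_on {0..} x"
    by (rule DERIV_continuous_on[OF x]) auto
  have deriv: "(F has_real_derivative g t) (at t within {0..})" if "0 \<le> t" for t
    unfolding F_def g_def
    by (rule derivative_eq_intros refl survival_has_real_derivative[OF that] x[OF that])+
      (simp add: algebra_simps)
  have cont: "continuous_on {0..} g"
    unfolding g_def by (intro continuous_intros continuous_on_survival x_cont y_cont a_cont)
  have nonneg': "0 \<le> g t" if "0 \<le> t" for t
    unfolding g_def using nonneg[OF that] survival_pos[of t] by simp
  have "((\<lambda>t. exp (- \<rho> * t)) \<longlongrightarrow> 0) at_top"
    using \<rho> by real_asymp
  moreover have "\<forall>\<^sub>F t in at_top. norm (F t) \<le> exp (- \<rho> * t)"
    using eventually_ge_at_top[of 0]
  proof eventually_elim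
    case (elim t)
    have "survival \<nu> \<kappa> a t * x t \<le> 1"
      using survival_le_1[of t] survival_pos[of t] x_unit[OF elim] by (intro mult_le_one) auto
    then show ?case
      using survival_pos[of t] x_unit[OF elim] by (simp add: F_def abs_mult)
  qed
  ultimately have lim: "(F \<longlongrightarrow> 0) at_top"
    by (rule Lim_null_comparison[rotated])
  show "set_integrable lborel {0..} g"
    by (rule set_integral_FTC_atLeast_nonneg[OF deriv cont nonneg' lim])
  show "(LBINT t:{0..}. g t) = x 0"
    using set_integral_FTC_atLeast_nonneg(2)[OF deriv cont nonneg' lim]
    by (simp add: F_def survival_0)
qed

text \<open>With \<open>\<rho>\<close> added to the hazard the kernel has mass exactly 1. The ratio
  \<open>(\<kappa> + \<nu> * a) / (\<rho> + \<kappa> + \<nu> * a)\<close> increases in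
  \<open>a\<close>, so its value at \<open>a = 1\<close> bounds the share that belongs to resets and
  sales.\<close>

lemma discounted_hazard_le:
  assumes \<rho>: "0 < \<rho>" and a_le_1: "\<And>t. 0 \<le> t \<Longrightarrow> a t \<le> 1"
  defines "g \<equiv> \<lambda>t. exp (- \<rho> * t) * (survival \<nu> \<kappa> a t * (\<kappa> + \<nu> * a t))"
  shows "set_integrable lborel {0..} g" and "(LBINT t:{0..}. g t) \<le> (\<kappa> + \<nu>) / (\<rho> + \<kappa> + \<nu>)"
proof -
  define h where "h = (\<lambda>t. exp (- \<rho> * t) * (survival \<nu> \<kappa> a t * (\<rho> + \<kappa> + \<nu> * a t)))"
  define k where "k = (\<kappa> + \<nu>) / (\<rho> + \<kappa> + \<nu>)"
  have h: "set_integrable lborel {0..} h" "(LBINT t:{0..}. h t) = 1"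
    unfolding h_def
    using discounted_integral_of_derivative[where x = "\<lambda>_. 1" and y = "\<lambda>_. 0", OF \<rho>] \<rho> \<nu> \<kappa> a_nonneg
    by (simp_all add: add_nonneg_nonneg)
  have g_nonneg: "0 \<le> g t" if "0 \<le> t" for t
    unfolding g_def using survival_pos[of t] \<nu> \<kappa> a_nonneg[OF that] by simp
  have g_le: "g t \<le> k * h t" if "0 \<le> t" for t
  proof -
    \<comment> \<open>This is what the ratio bound reduces to after cross-multiplication and
      cancellation.\<close>
    have "\<rho> * (\<nu> * a t) \<le> \<rho> * \<nu>"
      using a_le_1[OF that] \<rho> \<nu> by simp
    then have "\<kappa> + \<nu> * a t \<le> k * (\<rho> + \<kappa> + \<nu> * a t)"
      unfolding k_def using \<rho> \<nu> \<kappa> by (simp add: field_simps)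
    from mult_left_mono[OF this, of "exp (- \<rho> * t) * survival \<nu> \<kappa> a t"] show ?thesis
      using survival_pos[of t] by (simp add: g_def h_def mult_ac)
  qed
  have kh: "set_integrable lborel {0..} (\<lambda>t. k * h t)"
    using h by simp
  have g_cont: "continuous_on {0..} g"
    unfolding g_def by (intro continuous_intros continuous_on_survival a_cont)
  show g: "set_integrable lborel {0..} g"
  proof (rule set_integrable_bound[OF kh])
    show "set_borel_measurable lborel {0..} g"
      using borel_measurable_continuous_on_indicator[OF _ g_cont] by (simp add: set_borel_measurable_def)
    have "norm (g t) \<le> norm (k * h t)" if "0 \<le> t" for t
      using g_nonneg[OF that] g_le[OF that] by simp
    then show "AE t in lborel. t \<in> {0..} \<longrightarrow> norm (g t) \<le> norm (k * h t)"
      by auto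
  qed
  have "(LBINT t:{0..}. g t) \<le> (LBINT t:{0..}. k * h t)"
    using g_le by (intro set_integral_mono g kh) auto
  then show "(LBINT t:{0..}. g t) \<le> (\<kappa> + \<nu>) / (\<rho> + \<kappa> + \<nu>)"
    using h(2) by (simp add: k_def)
qed

end

section \<open>Uniqueness of bounded solutions\<close>

lemma bounded_solution_bound:
  assumes "bounded_solution \<rho> P G f"
  obtains B where "\<And>\<mu> p. \<mu> \<in> {0..1} \<Longrightarrow> p \<in> P \<Longrightarrow> \<bar>f \<mu> p\<bar> \<le> B"
proof -
  obtain B where "\<forall>y\<in>(\<lambda>(\<mu>, p). f \<mu> p) ` ({0..1} \<times> P). norm y \<le> B"
    using assms unfolding bounded_solution_def bounded_iff by blast
  then have "\<bar>f \<mu> p\<bar> \<le> B" if "\<mu> \<in> {0..1}" "p \<in> P" for \<mu> p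
    using that by fastforce
  then show thesis
    by (rule that)
qed

text \<open>The right-hand side is a contraction in the supremum norm with modulus
  \<open>(\<kappa> + \<nu>) / (\<rho> + \<kappa> + \<nu>)\<close>.\<close>

lemma bounded_solution_unique:
  fixes f g :: "real \<Rightarrow> real \<Rightarrow> real" and a :: "real \<Rightarrow> real \<Rightarrow> real \<Rightarrow> real"
  assumes \<rho>: "0 < \<rho>" and \<nu>: "0 < \<nu>" and \<kappa>: "0 < \<kappa>"
    and f: "bounded_solution \<rho> P G f" and g: "bounded_solution \<rho> P G g"
    and a_cont: "\<And>\<mu> p. \<mu> \<in> {0..1} \<Longrightarrow> p \<in> P \<Longrightarrow> continuous_on {0..} (a \<mu> p)"
    and a_unit: "\<And>\<mu> p t. \<mu> \<in> {0..1} \<Longrightarrow> p \<in> P \<Longrightarrow> 0 \<le> t \<Longrightarrow> a \<mu> p t \<in> {0..1}"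
    and G_diff: "\<And>\<mu> p t M. \<mu> \<in> {0..1} \<Longrightarrow> p \<in> P \<Longrightarrow> 0 \<le> t \<Longrightarrow>
        (\<And>\<mu> p. \<mu> \<in> {0..1} \<Longrightarrow> p \<in> P \<Longrightarrow> \<bar>f \<mu> p - g \<mu> p\<bar> \<le> M) \<Longrightarrow>
        \<bar>G f \<mu> p t - G g \<mu> p t\<bar> \<le> survival \<nu> \<kappa> (a \<mu> p) t * (\<kappa> + \<nu> * a \<mu> p t) * M"
    and dom: "\<mu> \<in> {0..1}" "p \<in> P"
  shows "f \<mu> p = g \<mu> p"
proof -
  define E where "E = (\<lambda>(\<mu>, p). \<bar>f \<mu> p - g \<mu> p\<bar>) ` ({0..1} \<times> P)"
  define M where "M = Sup E"
  define k where "k = (\<kappa> + \<nu>) / (\<rho> + \<kappa> + \<nu>)"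
  obtain B C where B: "\<And>\<mu> p. \<mu> \<in> {0..1} \<Longrightarrow> p \<in> P \<Longrightarrow> \<bar>f \<mu> p\<bar> \<le> B"
    and C: "\<And>\<mu> p. \<mu> \<in> {0..1} \<Longrightarrow> p \<in> P \<Longrightarrow> \<bar>g \<mu> p\<bar> \<le> C"
    using bounded_solution_bound[OF f] bounded_solution_bound[OF g] by metis
  have "bdd_above E"
  proof (rule bdd_aboveI)
    fix e assume "e \<in> E"
    then obtain \<mu> p where "\<mu> \<in> {0..1}" "p \<in> P" "e = \<bar>f \<mu> p - g \<mu> p\<bar>"
      by (auto simp: E_def)
    then show "e \<le> B + C"
      using B[of \<mu> p] C[of \<mu> p] by simp
  qed
  then have le_M: "\<bar>f \<mu> p - g \<mu> p\<bar> \<le> M" if "\<mu> \<in> {0..1}" "p \<in> P" for \<mu> p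
    unfolding M_def using that by (intro cSup_upper) (auto simp: E_def)
  have M_nonneg: "0 \<le> M"
    using le_M[OF dom] by simp
  \<comment> \<open>One pass through the integral equation improves the uniform bound
    \<open>M\<close> to \<open>k * M\<close>: \<open>G_diff\<close> bounds the integrands pointwise
    by the hazard kernel times \<open>M\<close>, and that kernel has mass at most
    \<open>k\<close>.\<close>
  have le_kM: "\<bar>f \<mu> p - g \<mu> p\<bar> \<le> k * M" if dom: "\<mu> \<in> {0..1}" "p \<in> P" for \<mu> p
  proof -
    define F where "F = (\<lambda>t. exp (- \<rho> * t) * G f \<mu> p t - exp (- \<rho> * t) * G g \<mu> p t)"
    define h where "h = (\<lambda>t. exp (- \<rho> * t) * (survival \<nu> \<kappa> (a \<mu> p) t * (\<kappa> + \<nu> * a \<mu> p t)))"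
    have h: "set_integrable lborel {0..} h" "(LBINT t:{0..}. h t) \<le> k"
      using discounted_hazard_le[OF \<nu> \<kappa> a_cont[OF dom] _ \<rho>] a_unit[OF dom]
      unfolding h_def k_def by auto
    have F: "set_integrable lborel {0..} F" and eq: "f \<mu> p - g \<mu> p = (LBINT t:{0..}. F t)"
      using f g dom unfolding bounded_solution_def F_def by auto
    have bound: "\<bar>F t\<bar> \<le> M * h t" if "0 \<le> t" for t
    proof -
      have "\<bar>F t\<bar> = exp (- \<rho> * t) * \<bar>G f \<mu> p t - G g \<mu> p t\<bar>"
        by (simp add: F_def abs_mult flip: right_diff_distrib)
      also have "\<dots> \<le> exp (- \<rho> * t) * (survival \<nu> \<kappa> (a \<mu> p) t * (\<kappa> + \<nu> * a \<mu> p t) * M)"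
        using G_diff[OF dom that le_M] by (intro mult_left_mono) auto
      finally show ?thesis
        by (simp add: h_def mult_ac)
    qed
    have "\<bar>f \<mu> p - g \<mu> p\<bar> \<le> (LBINT t:{0..}. \<bar>F t\<bar>)"
      using set_integral_norm_bound[OF F] by (simp add: eq)
    also have "\<dots> \<le> (LBINT t:{0..}. M * h t)"
      using bound h(1) by (intro set_integral_mono set_integrable_abs F) auto
    also have "\<dots> \<le> k * M"
      using mult_left_mono[OF h(2) M_nonneg] by (simp add: mult.commute)
    finally show ?thesis .
  qed
  \<comment> \<open>The improved bound holds for every element of \<open>E\<close>, hence for its
    supremum. As \<open>1 - k = \<rho> / (\<rho> + \<kappa> + \<nu>)\<close> is positive,
    \<open>M\<close> must vanish.\<close>
  have "M \<le> k * M"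
    unfolding M_def using dom le_kM
    by (intro cSup_least) (auto simp: E_def M_def)
  then have "\<rho> * M \<le> 0"
    using \<rho> \<nu> \<kappa> by (simp add: k_def field_simps)
  then have "M = 0"
    using \<rho> M_nonneg by (simp add: mult_le_0_iff)
  then show ?thesis
    using le_M[OF dom] by simp
qed

section \<open>Lipschitz estimates, invariance of maximizers, and the logit\<close>

lemma abs_Max_diff_le:
  fixes f g :: "'a \<Rightarrow> real"
  assumes "finite A" "A \<noteq> {}" and "\<And>x. x \<in> A \<Longrightarrow> \<bar>f x - g x\<bar> \<le> M"
  shows "\<bar>Max (f ` A) - Max (g ` A)\<bar> \<le> M"
proof -
  \<comment> \<open>Stated for arbitrary functions so that exchanging \<open>f\<close> and
    \<open>g\<close> yields the other sign.\<close>
  have "Max (f ` A) \<le> Max (g ` A) + M" if "\<And>x. x \<in> A \<Longrightarrow> \<bar>f x - g x\<bar> \<le> M" for f g :: "'a \<Rightarrow> real"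
  proof (rule Max.boundedI)
    fix y assume "y \<in> f ` A"
    then obtain x where "x \<in> A" "y = f x" by auto
    then have "f x \<le> g x + M" "g x \<le> Max (g ` A)"
      using that[of x] assms(1) by auto
    then show "y \<le> Max (g ` A) + M"
      using \<open>y = f x\<close> by simp
  qed (use assms(1,2) in auto)
  from this[of f g] this[of g f] assms(3) show ?thesis
    by (simp add: abs_le_iff algebra_simps)
qed

text \<open>The running payoff \<open>w\<close> cancels, and the weights of the reset and sale terms
  add up to the total hazard. This is the form that the contraction argument asks for, in the
  aggregate and in the strategic equation alike.\<close>

lemma integrand_diff_le:
  fixes s A \<kappa> \<nu> w m m' j j' M :: real
  assumes "0 \<le> s" "0 \<le> A" "0 \<le> \<kappa>" "0 \<le> \<nu>" and "\<bar>m - m'\<bar> \<le> M" "\<bar>j - j'\<bar> \<le> M"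
  shows "\<bar>s * (w + \<kappa> * m + \<nu> * A * j) - s * (w + \<kappa> * m' + \<nu> * A * j')\<bar> \<le> s * (\<kappa> + \<nu> * A) * M"
proof -
  have "\<bar>\<kappa> * (m - m') + \<nu> * A * (j - j')\<bar> \<le> \<kappa> * \<bar>m - m'\<bar> + \<nu> * A * \<bar>j - j'\<bar>"
    using assms by (intro order_trans[OF abs_triangle_ineq]) (simp add: abs_mult)
  also have "\<dots> \<le> \<kappa> * M + \<nu> * A * M"
    using assms by (intro add_mono mult_left_mono) auto
  finally have "\<bar>\<kappa> * (m - m') + \<nu> * A * (j - j')\<bar> \<le> (\<kappa> + \<nu> * A) * M"
    by (simp add: algebra_simps)
  from mult_left_mono[OF this \<open>0 \<le> s\<close>]
  have "\<bar>s * (\<kappa> * (m - m') + \<nu> * A * (j - j'))\<bar> \<le> s * (\<kappa> + \<nu> * A) * M"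
    using assms by (simp add: abs_mult mult.assoc)
  then show ?thesis
    by (simp add: algebra_simps)
qed

text \<open>The belief is fixed here, so \<open>k\<close> may depend on it; only dependence on the
  price could move the maximizers.\<close>

lemma reset_set_diff_const:
  assumes "\<And>p. p \<in> P \<Longrightarrow> U \<mu> p = W \<mu> p - k"
  shows "reset_set P U \<mu> = reset_set P W \<mu>"
  using assms by (auto simp: reset_set_def is_arg_max_def)

lemma logistic_unit: "0 < logistic z" "logistic z < 1"
  by (simp_all add: logistic_def add_pos_pos)

lemma continuous_on_logistic [continuous_intros]:
  fixes f :: "real \<Rightarrow> real"
  assumes "continuous_on S f"
  shows "continuous_on S (\<lambda>x. logistic (f x))"
proof -
  have "1 + exp z \<noteq> 0" for z :: real
    using exp_gt_zero[of z] by linarith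
  then show ?thesis
    unfolding logistic_def using assms by (intro continuous_intros) auto
qed

lemma convex_unit:
  fixes x y w :: real
  assumes "0 < w" "w < 1" "0 < x" "x < 1" "0 < y" "y < 1"
  shows "0 < w * x + (1 - w) * y" "w * x + (1 - w) * y < 1"
proof -
  show "0 < w * x + (1 - w) * y"
    using assms by (simp add: add_pos_pos)
  have "w * x + (1 - w) * y < w * 1 + (1 - w) * 1"
    using assms by (intro add_strict_mono mult_strict_left_mono) auto
  then show "w * x + (1 - w) * y < 1"
    by simp
qed

section \<open>Purchase probabilities, Bayes jumps and the belief flow\<close>

locale market =
  fixes \<rho> \<nu> \<kappa> v \<zeta> q :: real and P :: "real set" and \<phi> :: "real \<Rightarrow> real \<Rightarrow> real \<Rightarrow> real"
  assumes \<rho>: "0 < \<rho>" and \<nu>: "0 < \<nu>" and \<kappa>: "0 < \<kappa>" and \<zeta>: "0 < \<zeta>"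
    and q: "0 < q" "q < 1"
    and finite_P: "finite P" and P_nonempty: "P \<noteq> {}"
    and flow: "is_flow \<nu> v \<zeta> q P \<phi>"
begin

lemma A_unit: "0 < A_H v \<zeta> q \<mu> p" "A_H v \<zeta> q \<mu> p < 1" "0 < A_L v \<zeta> q \<mu> p" "A_L v \<zeta> q \<mu> p < 1"
  using convex_unit[of q "b_H v \<zeta> q \<mu> p" "b_L v \<zeta> q \<mu> p"]
    convex_unit[of q "b_L v \<zeta> q \<mu> p" "b_H v \<zeta> q \<mu> p"] q
  by (simp_all add: A_H_def A_L_def b_H_def b_L_def logistic_unit add.commute)

lemma A_bar_convex: "A_bar v \<zeta> q \<mu> p = \<mu> * A_H v \<zeta> q \<mu> p + (1 - \<mu>) * A_L v \<zeta> q \<mu> p"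
  by (simp add: A_bar_def D_0_def algebra_simps)

lemma A_bar_unit:
  assumes "\<mu> \<in> {0..1}"
  shows "0 < A_bar v \<zeta> q \<mu> p" "A_bar v \<zeta> q \<mu> p < 1"
proof -
  \<comment> \<open>The endpoints are separated because \<open>convex_unit\<close> requires a weight
    strictly between 0 and 1.\<close>
  consider "\<mu> = 0" | "\<mu> = 1" | "0 < \<mu>" "\<mu> < 1"
    using assms by fastforce
  then have "0 < A_bar v \<zeta> q \<mu> p \<and> A_bar v \<zeta> q \<mu> p < 1"
    by cases (use A_unit convex_unit in \<open>simp_all add: A_bar_convex\<close>)
  then show "0 < A_bar v \<zeta> q \<mu> p" "A_bar v \<zeta> q \<mu> p < 1"
    by auto
qed

lemma jump_unit:
  assumes "\<mu> \<in> {0..1}"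
  shows "jump v \<zeta> q \<mu> p \<in> {0..1}"
proof -
  have "\<mu> * A_H v \<zeta> q \<mu> p \<le> A_bar v \<zeta> q \<mu> p" "0 \<le> \<mu> * A_H v \<zeta> q \<mu> p"
    using assms A_unit[of \<mu> p] by (simp_all add: A_bar_convex)
  then show ?thesis
    using A_bar_unit(1)[OF assms, of p] by (simp add: jump_def divide_le_eq_1)
qed

text \<open>Bayes' rule: both sides are the joint probability of the commitment type and a sale. The
  quotient in \<open>jump\<close> is harmless since \<open>A_bar\<close> is positive on the unit
  interval.\<close>

lemma A_bar_jump:
  assumes "\<mu> \<in> {0..1}"
  shows "A_bar v \<zeta> q \<mu> p * jump v \<zeta> q \<mu> p = \<mu> * A_H v \<zeta> q \<mu> p"
  using A_bar_unit[OF assms, of p] by (simp add: jump_def)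

lemma continuous_on_b:
  "continuous_on {0..1} (\<lambda>\<mu>. b_H v \<zeta> q \<mu> p)" "continuous_on {0..1} (\<lambda>\<mu>. b_L v \<zeta> q \<mu> p)"
proof -
  \<comment> \<open>The denominators of \<open>pi_H\<close> and \<open>pi_L\<close> are total signal
    probabilities, that is, mixtures of \<open>q\<close> and \<open>1 - q\<close>, and so stay
    positive.\<close>
  have "0 < (1 - q) + (2 * q - 1) * l" if "l \<in> {0..1}" for l
  proof -
    have "(1 - q) + (2 * q - 1) * l = (1 - q) * (1 - l) + q * l"
      by (simp add: algebra_simps)
    moreover have "0 < (1 - q) * (1 - l) + q * l"
      using that q by (cases "l = 0") (auto intro: add_nonneg_pos)
    ultimately show ?thesis by simp
  qed
  moreover have "0 < q - (2 * q - 1) * l" if "l \<in> {0..1}" for l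
  proof -
    have "q - (2 * q - 1) * l = q * (1 - l) + (1 - q) * l"
      by (simp add: algebra_simps)
    moreover have "0 < q * (1 - l) + (1 - q) * l"
      using that q by (cases "l = 0") (auto intro: add_nonneg_pos)
    ultimately show ?thesis by simp
  qed
  ultimately show
    "continuous_on {0..1} (\<lambda>\<mu>. b_H v \<zeta> q \<mu> p)" "continuous_on {0..1} (\<lambda>\<mu>. b_L v \<zeta> q \<mu> p)"
    unfolding b_H_def b_L_def pi_H_def pi_L_def
    using \<zeta> by (intro continuous_intros; force)+
qed

context
  fixes \<mu> p :: real
  assumes \<mu>: "\<mu> \<in> {0..1}" and p: "p \<in> P"
begin

lemma flow_0: "\<phi> p \<mu> 0 = \<mu>"
  and flow_unit: "0 \<le> t \<Longrightarrow> \<phi> p \<mu> t \<in> {0..1}"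
  and flow_deriv: "0 \<le> t \<Longrightarrow>
    (\<phi> p \<mu> has_real_derivative drift \<nu> v \<zeta> q (\<phi> p \<mu> t) p) (at t within {0..})"
  using flow \<mu> p unfolding is_flow_def by blast+

lemma continuous_on_flow: "continuous_on {0..} (\<phi> p \<mu>)"
  by (rule DERIV_continuous_on[OF flow_deriv]) auto

lemma continuous_on_A_flow:
  "continuous_on {0..} (\<lambda>t. A_H v \<zeta> q (\<phi> p \<mu> t) p)"
  "continuous_on {0..} (\<lambda>t. A_L v \<zeta> q (\<phi> p \<mu> t) p)"
proof -
  have "\<phi> p \<mu> ` {0..} \<subseteq> {0..1}"
    using flow_unit by blast
  note b_flow = continuous_on_compose2[OF continuous_on_b(1) continuous_on_flow this]
    continuous_on_compose2[OF continuous_on_b(2) continuous_on_flow this]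
  show "continuous_on {0..} (\<lambda>t. A_H v \<zeta> q (\<phi> p \<mu> t) p)"
    "continuous_on {0..} (\<lambda>t. A_L v \<zeta> q (\<phi> p \<mu> t) p)"
    unfolding A_H_def A_L_def
    by (intro continuous_on_add continuous_on_mult_left b_flow)+
qed

lemma continuous_on_A_bar_flow: "continuous_on {0..} (\<lambda>t. A_bar v \<zeta> q (\<phi> p \<mu> t) p)"
  unfolding A_bar_def D_0_def by (intro continuous_intros continuous_on_A_flow continuous_on_flow)

text \<open>Drift and jumps balance, making the belief a martingale under the public law: its
  expectation stays at \<open>\<mu>\<close>, and a cost flow \<open>\<nu> * c\<close> times the
  belief is worth \<open>\<nu> * c / \<rho> * \<mu>\<close>. The lemma is this statement in
  fixed-point form.\<close>

lemma belief_identity: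
  fixes c :: real
  defines "g \<equiv> \<lambda>t. exp (- \<rho> * t) * (survival \<nu> \<kappa> (\<lambda>s. A_bar v \<zeta> q (\<phi> p \<mu> s) p) t *
    (\<nu> * c * \<phi> p \<mu> t + \<kappa> * (\<nu> * c / \<rho> * \<phi> p \<mu> t)
      + \<nu> * A_bar v \<zeta> q (\<phi> p \<mu> t) p * (\<nu> * c / \<rho> * jump v \<zeta> q (\<phi> p \<mu> t) p)))"
  shows "set_integrable lborel {0..} g" and "(LBINT t:{0..}. g t) = \<nu> * c / \<rho> * \<mu>"
proof -
  let ?a = "\<lambda>t. A_bar v \<zeta> q (\<phi> p \<mu> t) p" and ?y = "\<lambda>t. drift \<nu> v \<zeta> q (\<phi> p \<mu> t) p"
  \<comment> \<open>The cost-free core of \<open>g\<close>. It is nonnegative, as the half-line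
    integral requires; the factor \<open>\<nu> * c / \<rho>\<close>, of arbitrary sign, is
    multiplied in later.\<close>
  define h where "h = (\<lambda>t. exp (- \<rho> * t) *
    (survival \<nu> \<kappa> ?a t * ((\<rho> + \<kappa> + \<nu> * ?a t) * \<phi> p \<mu> t - ?y t)))"
  \<comment> \<open>Substituting the drift leaves only summands that are nonnegative along the
    flow.\<close>
  have bayes: "(\<rho> + \<kappa> + \<nu> * ?a t) * \<phi> p \<mu> t - ?y t
      = \<rho> * \<phi> p \<mu> t + \<kappa> * \<phi> p \<mu> t + \<nu> * (\<phi> p \<mu> t * A_H v \<zeta> q (\<phi> p \<mu> t) p)" for t
    by (simp add: A_bar_def drift_def D_0_def algebra_simps)
  have "continuous_on {0..} ?y"
    unfolding drift_def D_0_def by (intro continuous_intros continuous_on_A_flow continuous_on_flow)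
  moreover have "0 \<le> (\<rho> + \<kappa> + \<nu> * ?a t) * \<phi> p \<mu> t - ?y t" if "0 \<le> t" for t
    unfolding bayes using flow_unit[OF that] \<rho> \<kappa> \<nu> A_unit(1)[of "\<phi> p \<mu> t" p]
    by (simp add: add_nonneg_nonneg)
  ultimately have h: "set_integrable lborel {0..} h" "(LBINT t:{0..}. h t) = \<mu>"
    using discounted_integral_of_derivative[OF \<nu> \<kappa> continuous_on_A_bar_flow _ \<rho> flow_deriv flow_unit]
      A_bar_unit(1)[OF flow_unit, THEN less_imp_le] flow_0
    unfolding h_def by auto
  have g_eq: "g t = \<nu> * c / \<rho> * h t" if "t \<in> {0..}" for t
  proof -
    have jump: "?a t * jump v \<zeta> q (\<phi> p \<mu> t) p = \<phi> p \<mu> t * A_H v \<zeta> q (\<phi> p \<mu> t) p"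
      using A_bar_jump flow_unit that by simp
    have "\<nu> * c * \<phi> p \<mu> t + \<kappa> * (\<nu> * c / \<rho> * \<phi> p \<mu> t)
        + \<nu> * ?a t * (\<nu> * c / \<rho> * jump v \<zeta> q (\<phi> p \<mu> t) p)
      = \<nu> * c / \<rho> * (\<rho> * \<phi> p \<mu> t + \<kappa> * \<phi> p \<mu> t
        + \<nu> * (?a t * jump v \<zeta> q (\<phi> p \<mu> t) p))"
      using \<rho> by (simp add: field_simps)
    then show ?thesis
      unfolding g_def h_def bayes jump by simp
  qed
  have "set_integrable lborel {0..} (\<lambda>t. \<nu> * c / \<rho> * h t)"
    using h(1) by (intro set_integrable_mult_right) simp
  then show "set_integrable lborel {0..} g"
    by (subst set_integrable_cong[OF refl refl g_eq]) auto
  have "(LBINT t:{0..}. g t) = (LBINT t:{0..}. \<nu> * c / \<rho> * h t)"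
    using g_eq by (intro set_lebesgue_integral_cong) auto
  then show "(LBINT t:{0..}. g t) = \<nu> * c / \<rho> * \<mu>"
    using h(2) by simp
qed

end

section \<open>Uniqueness of the values and removal of the quality cost\<close>

text \<open>The contraction argument applies with \<open>A_bar\<close> as purchase probability: the
  maximum over the menu is 1-Lipschitz, and flow and jump keep the belief in the unit interval,
  where \<open>M\<close> bounds the difference.\<close>

lemma aggregate_solution_unique:
  assumes f: "aggregate_solution \<rho> \<nu> \<kappa> v \<zeta> q P \<phi> w f"
    and g: "aggregate_solution \<rho> \<nu> \<kappa> v \<zeta> q P \<phi> w g"
    and "\<mu> \<in> {0..1}" "p \<in> P"
  shows "f \<mu> p = g \<mu> p"
proof (rule bounded_solution_unique[OF \<rho> \<nu> \<kappa> f[unfolded aggregate_solution_def]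
      g[unfolded aggregate_solution_def], where a = "\<lambda>\<mu> p t. A_bar v \<zeta> q (\<phi> p \<mu> t) p"])
  fix \<mu> p t M :: real
  assume dom: "\<mu> \<in> {0..1}" "p \<in> P" and t: "0 \<le> t"
    and M: "\<And>\<mu> p. \<mu> \<in> {0..1} \<Longrightarrow> p \<in> P \<Longrightarrow> \<bar>f \<mu> p - g \<mu> p\<bar> \<le> M"
  define x where "x = \<phi> p \<mu> t"
  define s where "s = survival \<nu> \<kappa> (\<lambda>s. A_bar v \<zeta> q (\<phi> p \<mu> s) p) t"
  define J where "J = jump v \<zeta> q x p"
  define A where "A = A_bar v \<zeta> q x p"
  define mf where "mf = (MAX p'\<in>P. f x p')"
  define mg where "mg = (MAX p'\<in>P. g x p')"
  have x: "x \<in> {0..1}"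
    using flow_unit[OF dom t] by (simp add: x_def)
  have A: "0 \<le> A"
    using A_bar_unit[OF x] by (simp add: A_def less_imp_le)
  have s: "0 \<le> s"
    by (simp add: s_def survival_def)
  have m: "\<bar>mf - mg\<bar> \<le> M"
    unfolding mf_def mg_def using finite_P P_nonempty M[OF x] by (rule abs_Max_diff_le)
  have j: "\<bar>f J p - g J p\<bar> \<le> M"
    using M jump_unit[OF x] dom(2) by (simp add: J_def)
  show "\<bar>s * (w (\<phi> p \<mu> t) p + \<kappa> * (MAX p'\<in>P. f (\<phi> p \<mu> t) p')
         + \<nu> * A_bar v \<zeta> q (\<phi> p \<mu> t) p * f (jump v \<zeta> q (\<phi> p \<mu> t) p) p)
       - s * (w (\<phi> p \<mu> t) p + \<kappa> * (MAX p'\<in>P. g (\<phi> p \<mu> t) p')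
         + \<nu> * A_bar v \<zeta> q (\<phi> p \<mu> t) p * g (jump v \<zeta> q (\<phi> p \<mu> t) p) p)\<bar>
      \<le> s * (\<kappa> + \<nu> * A_bar v \<zeta> q (\<phi> p \<mu> t) p) * M"
    using integrand_diff_le[OF s A less_imp_le[OF \<kappa>] less_imp_le[OF \<nu>] m j] by (simp add: mf_def mg_def A_def J_def x_def)
next
  fix \<mu> p t :: real
  assume "\<mu> \<in> {0..1}" "p \<in> P" "0 \<le> t"
  then show "A_bar v \<zeta> q (\<phi> p \<mu> t) p \<in> {0..1}"
    using A_bar_unit[OF flow_unit, of \<mu> p t p] by simp
qed (use assms(3,4) continuous_on_A_bar_flow in simp_all)

lemma strategic_value_unique:
  assumes f: "is_strategic_value \<rho> \<nu> \<kappa> v \<zeta> q P \<phi> r f"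
    and g: "is_strategic_value \<rho> \<nu> \<kappa> v \<zeta> q P \<phi> r g"
    and r: "\<And>\<mu> p. \<mu> \<in> {0..1} \<Longrightarrow> p \<in> P \<Longrightarrow> set_pmf (r \<mu> p) \<subseteq> P"
    and "\<mu> \<in> {0..1}" "p \<in> P"
  shows "f \<mu> p = g \<mu> p"
proof (rule bounded_solution_unique[OF \<rho> \<nu> \<kappa> f[unfolded is_strategic_value_def]
      g[unfolded is_strategic_value_def], where a = "\<lambda>\<mu> p t. A_L v \<zeta> q (\<phi> p \<mu> t) p"])
  fix \<mu> p t M :: real
  assume dom: "\<mu> \<in> {0..1}" "p \<in> P" and t: "0 \<le> t"
    and M: "\<And>\<mu> p. \<mu> \<in> {0..1} \<Longrightarrow> p \<in> P \<Longrightarrow> \<bar>f \<mu> p - g \<mu> p\<bar> \<le> M"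
  define x where "x = \<phi> p \<mu> t"
  define s where "s = survival \<nu> \<kappa> (\<lambda>s. A_L v \<zeta> q (\<phi> p \<mu> s) p) t"
  define J where "J = jump v \<zeta> q x p"
  define A where "A = A_L v \<zeta> q x p"
  define mf where "mf = (\<Sum>p'\<in>P. pmf (r x p) p' * f x p')"
  define mg where "mg = (\<Sum>p'\<in>P. pmf (r x p) p' * g x p')"
  have x: "x \<in> {0..1}"
    using flow_unit[OF dom t] by (simp add: x_def)
  have A: "0 \<le> A"
    using A_unit(3) by (simp add: A_def less_imp_le)
  have s: "0 \<le> s"
    by (simp add: s_def survival_def)
  have "\<bar>mf - mg\<bar> = \<bar>\<Sum>p'\<in>P. pmf (r x p) p' * (f x p' - g x p')\<bar>"
    by (simp add: mf_def mg_def sum_subtractf right_diff_distrib)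
  also have "\<dots> \<le> (\<Sum>p'\<in>P. pmf (r x p) p' * M)"
    using M[OF x] by (intro order_trans[OF sum_abs] sum_mono) (auto simp: abs_mult intro!: mult_left_mono)
  \<comment> \<open>The support of \<open>r\<close> lies in the menu, so the weights sum to 1 and
    averaging does not enlarge \<open>M\<close>.\<close>
  also have "\<dots> = M"
    using sum_pmf_eq_1[OF finite_P r[OF x dom(2)]] by (simp flip: sum_distrib_right)
  finally have m: "\<bar>mf - mg\<bar> \<le> M" .
  have j: "\<bar>f J p - g J p\<bar> \<le> M"
    using M jump_unit[OF x] dom(2) by (simp add: J_def)
  show "\<bar>s * (\<nu> * p * A_L v \<zeta> q (\<phi> p \<mu> t) p
         + \<kappa> * (\<Sum>p'\<in>P. pmf (r (\<phi> p \<mu> t) p) p' * f (\<phi> p \<mu> t) p')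
         + \<nu> * A_L v \<zeta> q (\<phi> p \<mu> t) p * f (jump v \<zeta> q (\<phi> p \<mu> t) p) p)
       - s * (\<nu> * p * A_L v \<zeta> q (\<phi> p \<mu> t) p
         + \<kappa> * (\<Sum>p'\<in>P. pmf (r (\<phi> p \<mu> t) p) p' * g (\<phi> p \<mu> t) p')
         + \<nu> * A_L v \<zeta> q (\<phi> p \<mu> t) p * g (jump v \<zeta> q (\<phi> p \<mu> t) p) p)\<bar>
      \<le> s * (\<kappa> + \<nu> * A_L v \<zeta> q (\<phi> p \<mu> t) p) * M"
    using integrand_diff_le[OF s A less_imp_le[OF \<kappa>] less_imp_le[OF \<nu>] m j] by (simp add: mf_def mg_def A_def J_def x_def)
next
  fix \<mu> p t :: real
  show "A_L v \<zeta> q (\<phi> p \<mu> t) p \<in> {0..1}"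
    using A_unit(3,4)[of "\<phi> p \<mu> t" p] by simp
qed (use assms(4,5) continuous_on_A_flow in simp_all)

lemma gross_value_of_aggregate_value:
  fixes c :: real
  assumes U: "is_aggregate_value \<rho> \<nu> \<kappa> v \<zeta> q P \<phi> c U"
  shows "is_gross_value \<rho> \<nu> \<kappa> v \<zeta> q P \<phi> (\<lambda>\<mu> p. U \<mu> p + \<nu> * c / \<rho> * \<mu>)"
proof -
  let ?a = "\<lambda>\<mu> p t. A_bar v \<zeta> q (\<phi> p \<mu> t) p"
  let ?S = "\<lambda>\<mu> p. survival \<nu> \<kappa> (?a \<mu> p)"
  let ?J = "\<lambda>\<mu> p t. jump v \<zeta> q (\<phi> p \<mu> t) p"
  \<comment> \<open>Taking the running payoff as an argument makes the net and gross equations two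
    instances of one operator.\<close>
  define G where "G = (\<lambda>w f \<mu> p t. ?S \<mu> p t * (w (\<phi> p \<mu> t) p
    + \<kappa> * (MAX p'\<in>P. f (\<phi> p \<mu> t) p') + \<nu> * ?a \<mu> p t * f (?J \<mu> p t) p))"
  define w where "w = (\<lambda>\<mu> p. \<nu> * (p * A_bar v \<zeta> q \<mu> p - c * \<mu>))"
  define wg where "wg = (\<lambda>\<mu> p. \<nu> * p * A_bar v \<zeta> q \<mu> p)"
  define h where "h = (\<lambda>\<mu>. \<nu> * c / \<rho> * \<mu>)"
  define f where "f = (\<lambda>\<mu> p. U \<mu> p + h \<mu>)"
  define g where "g = (\<lambda>\<mu> p t. ?S \<mu> p t * (\<nu> * c * \<phi> p \<mu> t + \<kappa> * h (\<phi> p \<mu> t)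
    + \<nu> * ?a \<mu> p t * h (?J \<mu> p t)))"
  have U_sol: "bounded_solution \<rho> P (G w) U"
    using U by (simp add: is_aggregate_value_def aggregate_solution_def G_def w_def)
  then have U_integrable: "\<And>\<mu> p. \<mu> \<in> {0..1} \<Longrightarrow> p \<in> P \<Longrightarrow>
      set_integrable lborel {0..} (\<lambda>t. exp (- \<rho> * t) * G w U \<mu> p t)"
    and U_eq: "\<And>\<mu> p. \<mu> \<in> {0..1} \<Longrightarrow> p \<in> P \<Longrightarrow>
      U \<mu> p = (LBINT t:{0..}. exp (- \<rho> * t) * G w U \<mu> p t)"
    unfolding bounded_solution_def by blast+
  \<comment> \<open>The added term \<open>h\<close> does not depend on the price, so it leaves the
    maximum over the menu.\<close>
  have MAX_f: "(MAX p'\<in>P. f x p') = (MAX p'\<in>P. U x p') + h x" for x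
    unfolding f_def by (rule Max_add_commute[OF finite_P P_nonempty])
  \<comment> \<open>The gross integrand splits into the net integrand for \<open>U\<close> and the
    integrand of the belief identity, whose term \<open>\<nu> * c * \<phi> p \<mu> t\<close>
    restores the deducted cost.\<close>
  have G_f: "exp (- \<rho> * t) * G wg f \<mu> p t
      = exp (- \<rho> * t) * G w U \<mu> p t + exp (- \<rho> * t) * g \<mu> p t" for \<mu> p t
    unfolding G_def MAX_f by (simp add: g_def f_def w_def wg_def algebra_simps)
  have "bounded_solution \<rho> P (G wg) f"
    unfolding bounded_solution_def
  proof (intro conjI ballI)
    obtain B where B: "\<And>\<mu> p. \<mu> \<in> {0..1} \<Longrightarrow> p \<in> P \<Longrightarrow> \<bar>U \<mu> p\<bar> \<le> B"
      using bounded_solution_bound[OF U_sol] by blast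
    show "bounded ((\<lambda>(\<mu>, p). f \<mu> p) ` ({0..1} \<times> P))"
      unfolding bounded_iff
    proof (intro exI[of _ "B + \<bar>\<nu> * c / \<rho>\<bar>"] ballI)
      fix y assume "y \<in> (\<lambda>(\<mu>, p). f \<mu> p) ` ({0..1} \<times> P)"
      then obtain \<mu> p where dom: "\<mu> \<in> {0..1}" "p \<in> P" and y: "y = f \<mu> p"
        by auto
      have "\<bar>h \<mu>\<bar> \<le> \<bar>\<nu> * c / \<rho>\<bar>"
        using dom(1) by (simp add: h_def abs_mult mult_left_le divide_right_mono)
      then show "norm y \<le> B + \<bar>\<nu> * c / \<rho>\<bar>"
        using B[OF dom] by (simp add: y f_def)
    qed
  next
    fix \<mu> p :: real
    assume dom: "\<mu> \<in> {0..1}" "p \<in> P"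
    have g: "set_integrable lborel {0..} (\<lambda>t. exp (- \<rho> * t) * g \<mu> p t)"
      "(LBINT t:{0..}. exp (- \<rho> * t) * g \<mu> p t) = h \<mu>"
      using belief_identity[OF dom] by (simp_all only: g_def h_def)
    show "set_integrable lborel {0..} (\<lambda>t. exp (- \<rho> * t) * G wg f \<mu> p t)"
      unfolding G_f by (intro set_integral_add U_integrable[OF dom] g)
    show "f \<mu> p = (LBINT t:{0..}. exp (- \<rho> * t) * G wg f \<mu> p t)"
      unfolding G_f
      by (subst set_integral_add(2)[OF U_integrable[OF dom] g(1)]) (simp only: g U_eq[OF dom] f_def)
  qed
  then show ?thesis
    by (simp add: is_gross_value_def aggregate_solution_def G_def wg_def f_def h_def)
qed

end


section \<open>Independence of the reset sets and strategic values from the quality cost\<close>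

theorem proposition5:
  fixes \<rho> \<nu> \<kappa> v \<zeta> q :: real and P :: "real set"
    and \<phi> :: "real \<Rightarrow> real \<Rightarrow> real \<Rightarrow> real"
    and Ut :: "real \<Rightarrow> real \<Rightarrow> real"
    and U :: "real \<Rightarrow> real \<Rightarrow> real \<Rightarrow> real"
    and V :: "real \<Rightarrow> (real \<Rightarrow> real \<Rightarrow> real pmf) \<Rightarrow> real \<Rightarrow> real \<Rightarrow> real"
  assumes "\<rho> > 0" and "\<nu> > 0" and "\<kappa> > 0" and "v > 0" and "\<zeta> > 0"
    and "1 / 2 < q" and "q < 1"
    and "finite P" and "P \<noteq> {}" and "P \<subseteq> {0<..}"
    and "is_flow \<nu> v \<zeta> q P \<phi>"
    and "is_gross_value \<rho> \<nu> \<kappa> v \<zeta> q P \<phi> Ut"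
    and "\<And>c. c > 0 \<Longrightarrow> is_aggregate_value \<rho> \<nu> \<kappa> v \<zeta> q P \<phi> c (U c)"
    and "\<And>c r. c > 0 \<Longrightarrow> exact_selector P (U c) r \<Longrightarrow>
           is_strategic_value \<rho> \<nu> \<kappa> v \<zeta> q P \<phi> r (V c r)"
  shows "(\<forall>c>0. \<forall>r. exact_selector P (U c) r \<longrightarrow>
            (\<forall>\<mu>\<in>{0..1}. \<forall>p\<in>P. U c \<mu> p = Ut \<mu> p - \<nu> * c / \<rho> * \<mu>)) \<and>
         (\<forall>c>0. \<forall>c'>0.
            (\<forall>\<mu>\<in>{0..1}. reset_set P (U c) \<mu> = reset_set P (U c') \<mu>) \<and>
            (\<forall>r. exact_selector P (U c) r \<longrightarrow>
               (\<forall>\<mu>\<in>{0..1}. \<forall>p\<in>P. V c r \<mu> p = V c' r \<mu> p)))"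
proof -
  interpret market \<rho> \<nu> \<kappa> v \<zeta> q P \<phi>
    by unfold_locales (use assms in auto)
  have U_eq: "U c \<mu> p = Ut \<mu> p - \<nu> * c / \<rho> * \<mu>" if "0 < c" "\<mu> \<in> {0..1}" "p \<in> P" for c \<mu> p
    using aggregate_solution_unique[OF
        gross_value_of_aggregate_value[OF assms(13)[OF \<open>0 < c\<close>], unfolded is_gross_value_def]
        assms(12)[unfolded is_gross_value_def] that(2,3)]
    by simp
  \<comment> \<open>Two costs are compared through \<open>Ut\<close>, which involves
    neither.\<close>
  have reset_gross: "reset_set P (U c) \<mu> = reset_set P Ut \<mu>" if "0 < c" "\<mu> \<in> {0..1}" for c \<mu>
    using U_eq[OF that] by (rule reset_set_diff_const[where k = "\<nu> * c / \<rho> * \<mu>"])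
  have selector: "exact_selector P (U c) r \<longleftrightarrow> exact_selector P Ut r" if "0 < c" for c r
    unfolding exact_selector_def using reset_gross[OF that] by simp
  have V_eq: "V c r \<mu> p = V c' r \<mu> p"
    if c: "0 < c" "0 < c'" and r: "exact_selector P (U c) r" and dom: "\<mu> \<in> {0..1}" "p \<in> P"
    for c c' r \<mu> p
  \<comment> \<open>The strategic equation involves the cost only through \<open>r\<close>. Once
    \<open>r\<close> is a selector for \<open>c'\<close> too, both values solve the same
    equation.\<close>
  proof (rule strategic_value_unique[OF assms(14)[OF c(1) r] assms(14)[OF c(2)] _ dom])
    show "exact_selector P (U c') r"
      using r selector c by simp
    show "set_pmf (r \<mu> p) \<subseteq> P" if "\<mu> \<in> {0..1}" "p \<in> P" for \<mu> p
      using r that unfolding exact_selector_def reset_set_def is_arg_max_def by fast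
  qed
  show ?thesis
    using U_eq reset_gross V_eq by simp
qed

end
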